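(* Let $X\subseteq\mathbb{R}^{p}$, $Y\subseteq\mathbb{R}^{m}$ be closed convex sets, $W=X\times Y$, $A\in\mathbb{R}^{m\times p}$, and $f(x,y)=y^TAx+G(x)-F^*(y)$ on $W$, where $G:X\to\mathbb{R}$ is continuous and convex, and $F^*:Y\to\mathbb{R}$ is continuous and convex and is the convex conjugate of a continuous convex function $F$. Distances are Euclidean. Let $L=\|A\|_2$ (spectral norm), $\theta\in(0,L]$, $\gamma=0.7/L$, $\beta=0.5$, $\epsilon\in(0,1)$, $v_0\in W$. Let $W^*$ (nonempty) be the optimal set defined in the context and suppose that for all $w\in W$, with $r^*=\|W^*-w\|$, one has $\theta(r^* )^2\le\Delta_{r^*}(w)$. Let $\{v_i\}$, $\{\tau_i\}$ be generated by adaptively restarted PDHG (defined in the context) from $v_0$ with step size $\gamma$, parameter $\beta$ and arbitrary initial epoch length $\tau_1\in\mathbb{N}$. Then at most $$57\,\frac L\theta\,\ln\!\left(\frac4\epsilon\right)+\max\left\{57\,\frac L\theta\,\ln\!\left(\max\left\{1,\frac{77L}{\theta\tau_1}\right\}\right),\ 2\tau_1\right\}$$ PDHG steps are required until some $v_n$ satisfies $\|W^*-v_n\|\le\epsilon\|W^*-v_0\|$; that is, there is $n\in\mathbb{N}$ with $\|W^*-v_n\|\le\epsilon\|W^*-v_0\|$ and $\sum_{i=1}^n\tau_i$ at most the displayed quantity.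
   Context: $\mathbb{N}=\{1,2,\dots\}$; $\|\cdot\|$ is the Euclidean norm; $w=(w_x,w_y)\in W$; $B_r(w)=\{\hat w\in W:\|w-\hat w\|\le r\}$; $\|\hat W-w\|=\inf_{\hat w\in\hat W}\|\hat w-w\|$. The localized duality gap is $\Delta_r(w)=\sup_{(x,y)\in B_r(w)} f(w_x,y)-f(x,w_y)$ and $W^*=\{w\in W:\Delta_r(w)=0\ \forall r>0\}$. PDHG (primal-dual hybrid gradient) from $v\in W$ with step size $\gamma$: set $u^0=v$, $\hat x^0=v_x$, and for $t=1,2,\dots$ $$u^t_y=\arg\min_{y\in Y}F^*(y)-y^TA\hat x^{t-1}+\tfrac1{2\gamma}\|y-u^{t-1}_y\|^2,$$ $$u^t_x=\arg\min_{x\in X}G(x)+(u^t_y)^TAx+\tfrac1{2\gamma}\|x-u^{t-1}_x\|^2,\qquad \hat x^t=2u^t_x-u^{t-1}_x .$$ The output at step $t$ is the running average $w^t(v)=\frac1t\sum_{k=1}^tu^k$. Adaptively restarted PDHG with parameter $\beta$: given $v_0\in W$, for epochs $i=1,2,\dots$ run PDHG from $v_{i-1}$, producing $w_i^t=w^t(v_{i-1})$. Epoch $1$ is stopped after an arbitrarily chosen number $\tau_1\in\mathbb{N}$ of steps. For $i>1$, epoch $i$ is stopped at the first $t\in\mathbb{N}$ (called $\tau_i$) with $$\frac{\|w_i^t-v_{i-1}\|}{t}\le\beta\,\frac{\|v_{i-1}-v_{i-2}\|}{\tau_{i-1}}.$$ Set $v_i=w_i^{\tau_i}$. *)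

theory Defs
  imports "HOL-Analysis.Analysis"
begin

text \<open>
  The primal space is \<open>real ^ 'p\<close>, the dual space is \<open>real ^ 'm\<close>, and points \<open>w = (w\<^sub>x, w\<^sub>y)\<close>
  of \<open>W = X \<times> Y\<close> are pairs; the product norm of the library is the Euclidean norm of the
  concatenated vector. Functions on \<open>X\<close> or \<open>Y\<close> are total functions whose values outside these
  sets are never used.
\<close>

definition convex_conjugate ::
  "'a::real_inner set \<Rightarrow> ('a \<Rightarrow> real) \<Rightarrow> 'a \<Rightarrow> ereal" where
  "convex_conjugate Z F y = (SUP z\<in>Z. ereal (y \<bullet> z - F z))"

definition saddle_fun ::
  "real ^ 'p ^ 'm \<Rightarrow> (real ^ 'p \<Rightarrow> real) \<Rightarrow> (real ^ 'm \<Rightarrow> real) \<Rightarrow> real ^ 'p \<Rightarrow> real ^ 'm \<Rightarrow> real" where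
  "saddle_fun A G Fs x y = y \<bullet> (A *v x) + G x - Fs y"

text \<open>
  The supremum in the next definition is that of a continuous function over a nonempty compact
  set whenever \<open>X\<close>, \<open>Y\<close> are closed, \<open>G\<close>, \<open>Fs\<close> are continuous, \<open>w \<in> X \<times> Y\<close> and \<open>r \<ge> 0\<close>, so
  the real-valued supremum is a genuine one.
\<close>

definition local_gap ::
  "(real ^ 'p) set \<Rightarrow> (real ^ 'm) set \<Rightarrow> (real ^ 'p \<Rightarrow> real ^ 'm \<Rightarrow> real) \<Rightarrow> real
    \<Rightarrow> (real ^ 'p) \<times> (real ^ 'm) \<Rightarrow> real" where
  "local_gap X Y f r w = (SUP (x, y)\<in>cball w r \<inter> X \<times> Y. f (fst w) y - f x (snd w))"

definition optimal_set ::
  "(real ^ 'p) set \<Rightarrow> (real ^ 'm) set \<Rightarrow> (real ^ 'p \<Rightarrow> real ^ 'm \<Rightarrow> real)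
    \<Rightarrow> ((real ^ 'p) \<times> (real ^ 'm)) set" where
  "optimal_set X Y f = {w \<in> X \<times> Y. \<forall>r>0. local_gap X Y f r w = 0}"

text \<open>The state after \<open>t\<close> steps is \<open>(u\<^sup>t, xh\<^sup>t)\<close>, where \<open>xh\<^sup>t\<close> is the extrapolated primal point.\<close>

primrec pdhg_state ::
  "(real ^ 'p) set \<Rightarrow> (real ^ 'm) set \<Rightarrow> real ^ 'p ^ 'm \<Rightarrow> (real ^ 'p \<Rightarrow> real) \<Rightarrow> (real ^ 'm \<Rightarrow> real)
    \<Rightarrow> real \<Rightarrow> (real ^ 'p) \<times> (real ^ 'm) \<Rightarrow> nat \<Rightarrow> ((real ^ 'p) \<times> (real ^ 'm)) \<times> (real ^ 'p)" where
  "pdhg_state X Y A G Fs \<gamma> v 0 = (v, fst v)"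
| "pdhg_state X Y A G Fs \<gamma> v (Suc t) =
    (let (u, xh) = pdhg_state X Y A G Fs \<gamma> v t;
         y' = arg_min_on (\<lambda>y. Fs y - y \<bullet> (A *v xh) + 1 / (2 * \<gamma>) * (norm (y - snd u))\<^sup>2) Y;
         x' = arg_min_on (\<lambda>x. G x + y' \<bullet> (A *v x) + 1 / (2 * \<gamma>) * (norm (x - fst u))\<^sup>2) X
     in ((x', y'), 2 *\<^sub>R x' - fst u))"

definition pdhg_average ::
  "(real ^ 'p) set \<Rightarrow> (real ^ 'm) set \<Rightarrow> real ^ 'p ^ 'm \<Rightarrow> (real ^ 'p \<Rightarrow> real) \<Rightarrow> (real ^ 'm \<Rightarrow> real)
    \<Rightarrow> real \<Rightarrow> (real ^ 'p) \<times> (real ^ 'm) \<Rightarrow> nat \<Rightarrow> (real ^ 'p) \<times> (real ^ 'm)" where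
  "pdhg_average X Y A G Fs \<gamma> v t =
    (1 / real t) *\<^sub>R (\<Sum>k=1..t. fst (pdhg_state X Y A G Fs \<gamma> v k))"

text \<open>
  The restart scheme below is stated for an arbitrary method \<open>alg\<close>, where \<open>alg v t\<close> is the output
  after \<open>t\<close> steps from \<open>v\<close>. The restart test for step \<open>t\<close> of epoch \<open>i\<close> is meaningful only
  for \<open>i \<ge> 2\<close>.
\<close>

definition restart_test ::
  "('w::real_normed_vector \<Rightarrow> nat \<Rightarrow> 'w) \<Rightarrow> real \<Rightarrow> (nat \<Rightarrow> 'w) \<Rightarrow> (nat \<Rightarrow> nat) \<Rightarrow> nat \<Rightarrow> nat \<Rightarrow> bool" where
  "restart_test alg \<beta> v \<tau> i t \<longleftrightarrow>
    norm (alg (v (i - 1)) t - v (i - 1)) / real t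
      \<le> \<beta> * (norm (v (i - 1) - v (i - 2)) / real (\<tau> (i - 1)))"

text \<open>
  Termination of the epochs is not assumed: if epoch \<open>i\<close> never passes the test, \<open>LEAST\<close> leaves
  \<open>\<tau> i\<close> unspecified. The value \<open>\<tau> 0\<close> is irrelevant.
\<close>

definition adaptive_restart ::
  "('w::real_normed_vector \<Rightarrow> nat \<Rightarrow> 'w) \<Rightarrow> real \<Rightarrow> (nat \<Rightarrow> 'w) \<Rightarrow> (nat \<Rightarrow> nat) \<Rightarrow> bool" where
  "adaptive_restart alg \<beta> v \<tau> \<longleftrightarrow>
    1 \<le> \<tau> 1 \<and>
    (\<forall>i\<ge>2. \<tau> i = (LEAST t. 1 \<le> t \<and> restart_test alg \<beta> v \<tau> i t)) \<and>
    (\<forall>i\<ge>1. v i = alg (v (i - 1)) (\<tau> i))"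

end

theory Submission
  imports Defs
begin

text \<open>
  Telescoping the three-point inequalities of the proximal steps bounds the gap of the average
  \<open>w\<^sup>t\<close> of PDHG from \<open>v\<close> towards \<open>w\<close> by \<open>\<parallel>w - v\<parallel>\<^sup>2 / (2 \<gamma> t)\<close> and keeps the iterates within
  \<open>3/2\<close> times the initial distance to every optimal point. By concavity the growth condition at
  radius \<open>d\<close>, the distance of \<open>w\<^sup>t\<close> to the optimal set, yields a lower bound on the localized
  gap at all smaller radii too. Playing the two bounds against each other at the radius
  \<open>min d \<parallel>w\<^sup>t - v\<parallel>\<close> gives, with \<open>\<kappa> = L / \<theta>\<close>,
  \<open>d \<le> (20/7 \<kappa> + t/10) \<parallel>w\<^sup>t - v\<parallel> / t\<close> for every \<open>t\<close>, however short the epoch. Hence an epoch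
  that follows one of length \<open>\<tau>\<close> passes its test within \<open>16 \<kappa> + \<tau> / 2\<close> steps: epoch lengths
  contract towards \<open>32 \<kappa>\<close> while the normalized movement \<open>\<parallel>v\<^sub>i - v\<^sub>i\<^sub>-\<^sub>1\<parallel> / \<tau>\<^sub>i\<close> halves in each epoch.
\<close>

section \<open>Proximal steps\<close>

text \<open>Away from a base point a convex \<open>h\<close> decreases at most linearly, and the
  quadratic eventually dominates this. Minimizing over a large compact ball is therefore enough,
  although \<open>h\<close> itself may be unbounded below.\<close>

lemma convex_plus_square_attains_min:
  fixes h :: "'a::euclidean_space \<Rightarrow> real"
  assumes S: "closed S" "S \<noteq> {}" and h: "continuous_on S h" "convex_on S h" and c: "0 < c"
  shows "\<exists>p\<in>S. \<forall>x\<in>S. h p + c * (norm (p - a))\<^sup>2 \<le> h x + c * (norm (x - a))\<^sup>2"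
proof -
  obtain z where z: "z \<in> S" using S by auto
  have "compact (S \<inter> cball z 1)" using S by (simp add: closed_Int_compact)
  then obtain q where q: "q \<in> S \<inter> cball z 1" "\<And>x. x \<in> S \<inter> cball z 1 \<Longrightarrow> h q \<le> h x"
    using continuous_attains_inf[of "S \<inter> cball z 1" h] z h(1)
    by (metis IntI centre_in_cball continuous_on_subset empty_iff inf_le1 zero_le_one)
  define M where "M = h z - h q"
  have M: "0 \<le> M" using q(2)[of z] z by (simp add: M_def)
  have lower: "h z - M * (1 + norm (x - z)) \<le> h x" if x: "x \<in> S" for x
  proof (cases "norm (x - z) \<le> 1")
    case True
    then have "h q \<le> h x" using q(2)[of x] x by (simp add: dist_norm norm_minus_commute)
    moreover have "0 \<le> M * norm (x - z)" using M by simp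
    ultimately show ?thesis using M_def unfolding distrib_left by linarith
  next
    case False
    \<comment> \<open>The point \<open>p\<close> of the segment from \<open>z\<close> to
      \<open>x\<close> at distance 1 from \<open>z\<close> lies in the ball on which
      \<open>h q\<close> is minimal; convexity along the segment turns this into a bound at
      \<open>x\<close>.\<close>
    define r where "r = norm (x - z)"
    have r: "1 < r" using False by (simp add: r_def)
    define p where "p = (1 - 1/r) *\<^sub>R z + (1/r) *\<^sub>R x"
    have pS: "p \<in> S"
      unfolding p_def using convex_on_imp_convex[OF h(2)] z x r by (intro convexD) auto
    have "p - z = (1/r) *\<^sub>R (x - z)" by (simp add: p_def algebra_simps)
    then have "norm (p - z) = 1 / r * r" using r by (simp add: r_def)
    then have "norm (p - z) = 1" using r by simp
    then have "h q \<le> h p" using q(2)[of p] pS by (simp add: dist_norm norm_minus_commute)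
    also have "h p \<le> (1 - 1/r) * h z + (1/r) * h x"
      unfolding p_def using h(2) z x r by (intro convex_onD) auto
    finally have "r * h q \<le> r * ((1 - 1/r) * h z + (1/r) * h x)" using r by simp
    also have "\<dots> = (r - 1) * h z + h x" using r by (simp add: field_simps)
    finally have "h z - M * r \<le> h x" by (simp add: M_def algebra_simps)
    then show ?thesis using M by (simp add: r_def algebra_simps)
  qed
  define D where "D = norm (z - a)"
  define P where "P x = h x + c * (norm (x - a))\<^sup>2" for x
  \<comment> \<open>For \<open>r \<ge> R\<close> the quadratic gains
    \<open>c * r * (r - 2 * D) \<ge> 2 * M * r \<ge> M * (1 + r)\<close>, which covers the decrease
    of \<open>h\<close> allowed by \<open>lower\<close>.\<close>
  define R where "R = 1 + 2 * D + 2 * M / c"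
  have R: "1 \<le> R" using M c by (simp add: R_def D_def)
  have far: "P z \<le> P x" if x: "x \<in> S" and n: "R \<le> norm (x - z)" for x
  proof -
    define r where "r = norm (x - z)"
    have r: "1 \<le> r" "R \<le> r" using n R by (auto simp: r_def)
    have "r - D \<le> norm (x - a)"
      using norm_triangle_ineq[of "x - a" "a - z"] by (simp add: r_def D_def norm_minus_commute)
    moreover have "0 \<le> D" "0 \<le> 2 * M / c" using M c by (auto simp: D_def)
    then have "0 \<le> r - D" using r(2) unfolding R_def by linarith
    ultimately have "(r - D)\<^sup>2 \<le> (norm (x - a))\<^sup>2" by (simp add: power_mono)
    then have 1: "c * (r - D)\<^sup>2 \<le> c * (norm (x - a))\<^sup>2" using c by simp
    have "2 * M \<le> c * (r - 2 * D)" using r(2) c by (simp add: R_def field_simps)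
    then have "2 * M * r \<le> c * (r - 2 * D) * r" using r(1) by (simp add: mult_right_mono)
    moreover have "M * 1 \<le> M * r" using M r(1) by (rule mult_left_mono[rotated])
    ultimately have "M * (1 + r) \<le> c * (r - D)\<^sup>2 - c * D\<^sup>2"
      by (simp add: power2_eq_square algebra_simps)
    then show ?thesis using lower[OF x] 1 by (simp add: P_def r_def D_def)
  qed
  have "compact (S \<inter> cball z R)" using S by (simp add: closed_Int_compact)
  moreover have "continuous_on (S \<inter> cball z R) P"
    unfolding P_def using h(1) by (intro continuous_intros) (auto intro: continuous_on_subset)
  moreover have zR: "z \<in> S \<inter> cball z R" using z R by simp
  ultimately obtain p where p: "p \<in> S \<inter> cball z R" "\<And>x. x \<in> S \<inter> cball z R \<Longrightarrow> P p \<le> P x"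
    using continuous_attains_inf[of "S \<inter> cball z R" P] by blast
  have "P p \<le> P x" if x: "x \<in> S" for x
  proof (cases "norm (x - z) \<le> R")
    case True
    then show ?thesis using p(2)[of x] x by (simp add: dist_norm norm_minus_commute)
  next
    case False
    then show ?thesis using far[OF x] p(2)[OF zR] by simp
  qed
  then show ?thesis using p(1) unfolding P_def by blast
qed

text \<open>Minimality is tested against the point a fraction \<open>l\<close> of the way from
  \<open>p\<close> to \<open>x\<close>. Strong convexity of the square contributes the extra term
  with factor \<open>l * (1 - l)\<close>; dividing by \<open>l\<close> and letting \<open>l\<close>
  tend to 0 gives the full term.\<close>

lemma minimizer_three_point:
  fixes h :: "'a::real_inner \<Rightarrow> real"
  assumes h: "convex_on S h" and p: "p \<in> S" and x: "x \<in> S"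
    and min: "\<And>x. x \<in> S \<Longrightarrow> h p + c * (norm (p - a))\<^sup>2 \<le> h x + c * (norm (x - a))\<^sup>2"
  shows "h p + c * (norm (p - a))\<^sup>2 + c * (norm (x - p))\<^sup>2 \<le> h x + c * (norm (x - a))\<^sup>2"
proof -
  let ?lhs = "h p + c * (norm (p - a))\<^sup>2 + c * (norm (x - p))\<^sup>2 - (h x + c * (norm (x - a))\<^sup>2)"
  have *: "?lhs \<le> l * (c * (norm (x - p))\<^sup>2)" if l: "0 < l" "l < 1" for l :: real
  proof -
    define q where "q = (1 - l) *\<^sub>R p + l *\<^sub>R x"
    have q: "q \<in> S" unfolding q_def using convex_on_imp_convex[OF h] p x l by (intro convexD) auto
    have "h q \<le> (1 - l) * h p + l * h x"
      unfolding q_def using h p x l by (intro convex_onD) auto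
    moreover have "(norm (q - a))\<^sup>2
        = (1 - l) * (norm (p - a))\<^sup>2 + l * (norm (x - a))\<^sup>2 - l * (1 - l) * (norm (x - p))\<^sup>2"
      unfolding q_def power2_norm_eq_inner
      by (simp add: inner_simps inner_commute algebra_simps)
    ultimately have "h p + c * (norm (p - a))\<^sup>2 \<le> (1 - l) * h p + l * h x
        + c * ((1 - l) * (norm (p - a))\<^sup>2 + l * (norm (x - a))\<^sup>2 - l * (1 - l) * (norm (x - p))\<^sup>2)"
      using min[OF q] by simp
    then have "l * ?lhs \<le> l * (l * (c * (norm (x - p))\<^sup>2))" by (simp add: algebra_simps)
    then show ?thesis using l by simp
  qed
  have "((\<lambda>l. l * (c * (norm (x - p))\<^sup>2)) \<longlongrightarrow> 0 * (c * (norm (x - p))\<^sup>2)) (at_right 0)"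
    by (intro tendsto_intros)
  moreover have "\<forall>\<^sub>F l in at_right 0. ?lhs \<le> l * (c * (norm (x - p))\<^sup>2)"
    by (rule eventually_mono[OF eventually_at_right_real[OF zero_less_one]]) (use * in auto)
  ultimately have "?lhs \<le> 0 * (c * (norm (x - p))\<^sup>2)"
    by (rule tendsto_lowerbound) simp
  then show ?thesis by simp
qed

text \<open>\<open>arg_min_on\<close> is a choice operator, so it denotes a minimizer only once one
  is known to exist.\<close>

lemma arg_min_on_prox:
  fixes h :: "'a::euclidean_space \<Rightarrow> real" and a :: 'a
  assumes "closed S" "S \<noteq> {}" "continuous_on S h" and h: "convex_on S h" and "0 < c"
  defines "p \<equiv> arg_min_on (\<lambda>x. h x + c * (norm (x - a))\<^sup>2) S"
  shows "p \<in> S"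
    and "x \<in> S \<Longrightarrow> h p + c * (norm (p - a))\<^sup>2 + c * (norm (x - p))\<^sup>2 \<le> h x + c * (norm (x - a))\<^sup>2"
proof -
  have "\<exists>p. is_arg_min (\<lambda>x. h x + c * (norm (x - a))\<^sup>2) (\<lambda>x. x \<in> S) p"
    using convex_plus_square_attains_min[OF assms(1-5), of a] by (auto simp: is_arg_min_linorder)
  then have *: "is_arg_min (\<lambda>x. h x + c * (norm (x - a))\<^sup>2) (\<lambda>x. x \<in> S) p"
    unfolding p_def arg_min_on_def arg_min_def by (rule someI_ex)
  then show p: "p \<in> S" by (simp add: is_arg_min_linorder)
  show "h p + c * (norm (p - a))\<^sup>2 + c * (norm (x - p))\<^sup>2 \<le> h x + c * (norm (x - a))\<^sup>2"
    if "x \<in> S"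
    using * that by (intro minimizer_three_point[OF h p]) (auto simp: is_arg_min_linorder)
qed

section \<open>The ergodic bound for PDHG\<close>

locale saddle_problem =
  fixes X :: "(real ^ 'p) set" and Y :: "(real ^ 'm) set"
    and A :: "real ^ 'p ^ 'm" and G :: "real ^ 'p \<Rightarrow> real" and Fs :: "real ^ 'm \<Rightarrow> real"
  assumes closed_X: "closed X" and closed_Y: "closed Y"
    and cont_G: "continuous_on X G" and convex_G: "convex_on X G"
    and cont_Fs: "continuous_on Y Fs" and convex_Fs: "convex_on Y Fs"
begin

lemma convex_X: "convex X" and convex_Y: "convex Y"
  using convex_G convex_Fs convex_on_imp_convex by auto

text \<open>The localized duality gap is the supremum of \<open>gap w\<close> over a ball.
  Antisymmetry makes convexity in the first argument double as concavity in the second.\<close>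

definition gap :: "(real ^ 'p) \<times> (real ^ 'm) \<Rightarrow> (real ^ 'p) \<times> (real ^ 'm) \<Rightarrow> real" where
  "gap p q = saddle_fun A G Fs (fst p) (snd q) - saddle_fun A G Fs (fst q) (snd p)"

lemma gap_antisym: "gap p q = - gap q p"
  by (simp add: gap_def)

lemma gap_self: "gap p p = 0"
  by (simp add: gap_def)

lemma convex_on_gap: "convex_on (X \<times> Y) (\<lambda>p. gap p q)"
proof (rule convex_onI)
  show "convex (X \<times> Y)" using convex_X convex_Y by (rule convex_Times)
  fix l :: real and a b assume l: "0 < l" "l < 1" and ab: "a \<in> X \<times> Y" "b \<in> X \<times> Y"
  have "G ((1 - l) *\<^sub>R fst a + l *\<^sub>R fst b) \<le> (1 - l) * G (fst a) + l * G (fst b)"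
    using convex_G ab l by (intro convex_onD) auto
  moreover have "Fs ((1 - l) *\<^sub>R snd a + l *\<^sub>R snd b) \<le> (1 - l) * Fs (snd a) + l * Fs (snd b)"
    using convex_Fs ab l by (intro convex_onD) auto
  ultimately show "gap ((1 - l) *\<^sub>R a + l *\<^sub>R b) q \<le> (1 - l) * gap a q + l * gap b q"
    unfolding gap_def saddle_fun_def
    by (simp add: matrix_vector_right_distrib matrix_vector_mult_scaleR inner_simps algebra_simps)
qed

lemma continuous_on_gap: "continuous_on (X \<times> Y) (\<lambda>q. gap p q)"
proof -
  have "continuous_on (X \<times> Y) (\<lambda>q. G (fst q))"
    by (rule continuous_on_compose2[OF cont_G]) (auto intro!: continuous_intros)
  moreover have "continuous_on (X \<times> Y) (\<lambda>q. Fs (snd q))"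
    by (rule continuous_on_compose2[OF cont_Fs]) (auto intro!: continuous_intros)
  ultimately show ?thesis
    unfolding gap_def saddle_fun_def
    by (intro continuous_intros
        bounded_linear.continuous_on[OF matrix_vector_mul_bounded_linear])
qed

lemma local_gap_eq:
  "local_gap X Y (saddle_fun A G Fs) r w = (SUP q\<in>cball w r \<inter> X \<times> Y. gap w q)"
  unfolding local_gap_def gap_def by (simp add: case_prod_beta)

text \<open>A real \<open>SUP\<close> bounds its members only if they are bounded above, which
  compactness of the ball within the closed set \<open>X \<times> Y\<close> provides.\<close>

lemma gap_le_local_gap:
  assumes "q \<in> X \<times> Y" "dist w q \<le> r"
  shows "gap w q \<le> local_gap X Y (saddle_fun A G Fs) r w"
  unfolding local_gap_eq
proof (rule cSUP_upper)
  show "q \<in> cball w r \<inter> X \<times> Y" using assms by simp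
  have "compact (cball w r \<inter> X \<times> Y)"
    using closed_X closed_Y by (simp add: compact_Int_closed closed_Times)
  then have "compact (gap w ` (cball w r \<inter> X \<times> Y))"
    by (rule compact_continuous_image[rotated]) (auto intro: continuous_on_subset[OF continuous_on_gap])
  then show "bdd_above (gap w ` (cball w r \<inter> X \<times> Y))"
    by (intro bounded_imp_bdd_above compact_imp_bounded)
qed

lemma optimal_gap_nonpos:
  assumes "w \<in> optimal_set X Y (saddle_fun A G Fs)" "q \<in> X \<times> Y"
  shows "gap w q \<le> 0"
proof -
  \<comment> \<open>The radius must reach \<open>q\<close> and be positive; adding 1 covers
    \<open>q = w\<close>.\<close>
  have "gap w q \<le> local_gap X Y (saddle_fun A G Fs) (dist w q + 1) w"
    using assms by (intro gap_le_local_gap) auto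
  moreover have "0 < dist w q + 1" by (smt (verit) zero_le_dist)
  ultimately show ?thesis using assms(1) unfolding optimal_set_def by fastforce
qed

end

section \<open>PDHG iterates and their averages\<close>

locale pdhg = saddle_problem X Y A G Fs
  for X :: "(real ^ 'p) set" and Y :: "(real ^ 'm) set"
    and A :: "real ^ 'p ^ 'm" and G :: "real ^ 'p \<Rightarrow> real" and Fs :: "real ^ 'm \<Rightarrow> real" +
  fixes \<gamma> L :: real
  assumes L_bound: "\<And>x. norm (A *v x) \<le> L * norm x" and L_nonneg: "0 \<le> L"
    and step_pos: "0 < \<gamma>" and step_bound: "\<gamma> * L \<le> 1"
begin

abbreviation "state \<equiv> pdhg_state X Y A G Fs \<gamma>"
definition "c = 1 / (2 * \<gamma>)"

lemma c_pos: "0 < c" using step_pos by (simp add: c_def)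

text \<open>Young's inequality, with \<open>2 * c * \<gamma> = 1\<close>. The weight
  \<open>(\<gamma> * L)\<^sup>2\<close> sits entirely on the dual term, so that the primal term is
  exactly the one kept in the invariant below.\<close>

lemma inner_A_le: "y \<bullet> (A *v x) \<le> c * (norm y)\<^sup>2 * (\<gamma> * L)\<^sup>2 + c * (norm x)\<^sup>2"
proof -
  have "y \<bullet> (A *v x) \<le> norm y * norm (A *v x)" by (rule norm_cauchy_schwarz)
  also have "\<dots> \<le> norm y * (L * norm x)" by (intro mult_left_mono L_bound) simp
  also have "\<dots> \<le> c * (norm y)\<^sup>2 * (\<gamma> * L)\<^sup>2 + c * (norm x)\<^sup>2"
  proof -
    have "0 \<le> c * (\<gamma> * L * norm y - norm x)\<^sup>2" using c_pos by simp
    also have "\<dots> = c * (norm y)\<^sup>2 * (\<gamma> * L)\<^sup>2 + c * (norm x)\<^sup>2 - norm y * (L * norm x)"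
      using step_pos by (simp add: c_def power2_eq_square field_simps)
    finally show ?thesis by simp
  qed
  finally show ?thesis .
qed

text \<open>The dual and primal three-point inequalities are added; their bilinear terms collapse
  because \<open>x' - xh = \<delta>' - \<delta>\<close>. Here \<open>\<delta>\<close> is the
  extrapolation offset: 0 at the start, the last primal displacement afterwards.\<close>

lemma state_Suc_estimate:
  fixes v t w
  defines "u \<equiv> fst (state v t)" and "u' \<equiv> fst (state v (Suc t))"
    and "\<delta> \<equiv> snd (state v t) - fst (fst (state v t))"
    and "\<delta>' \<equiv> snd (state v (Suc t)) - fst (fst (state v (Suc t)))"
  assumes u: "u \<in> X \<times> Y"
  shows "u' \<in> X \<times> Y" and "\<delta>' = fst u' - fst u"
    and "w \<in> X \<times> Y \<Longrightarrow> gap u' w \<le> c * (norm (w - u))\<^sup>2 - c * (norm (w - u'))\<^sup>2 - c * (norm (u' - u))\<^sup>2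
      + (snd w - snd u') \<bullet> (A *v (\<delta>' - \<delta>))"
proof -
  define xh where "xh = snd (state v t)"
  define y' where "y' = arg_min_on (\<lambda>y. (Fs y - y \<bullet> (A *v xh)) + c * (norm (y - snd u))\<^sup>2) Y"
  define x' where "x' = arg_min_on (\<lambda>x. (G x + y' \<bullet> (A *v x)) + c * (norm (x - fst u))\<^sup>2) X"
  have st: "state v (Suc t) = ((x', y'), 2 *\<^sub>R x' - fst u)"
    by (simp add: Let_def case_prod_beta u_def xh_def y'_def x'_def c_def)
  then have u': "u' = (x', y')" by (simp add: u'_def)
  show \<delta>': "\<delta>' = fst u' - fst u" using st u' by (simp add: \<delta>'_def scaleR_2)
  have cY: "continuous_on Y (\<lambda>y. Fs y - y \<bullet> (A *v xh))"
    by (intro continuous_intros cont_Fs)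
  have vY: "convex_on Y (\<lambda>y. Fs y - y \<bullet> (A *v xh))"
  proof (rule convex_onI[OF _ convex_Y])
    fix l :: real and p q assume "0 < l" "l < 1" "p \<in> Y" "q \<in> Y"
    then have "Fs ((1 - l) *\<^sub>R p + l *\<^sub>R q) \<le> (1 - l) * Fs p + l * Fs q"
      by (intro convex_onD[OF convex_Fs]) auto
    then show "Fs ((1 - l) *\<^sub>R p + l *\<^sub>R q) - ((1 - l) *\<^sub>R p + l *\<^sub>R q) \<bullet> (A *v xh)
        \<le> (1 - l) * (Fs p - p \<bullet> (A *v xh)) + l * (Fs q - q \<bullet> (A *v xh))"
      by (simp add: inner_simps algebra_simps)
  qed
  have cX: "continuous_on X (\<lambda>x. G x + y' \<bullet> (A *v x))"
    by (intro continuous_intros cont_G bounded_linear.continuous_on[OF matrix_vector_mul_bounded_linear])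
  have vX: "convex_on X (\<lambda>x. G x + y' \<bullet> (A *v x))"
  proof (rule convex_onI[OF _ convex_X])
    fix l :: real and p q assume "0 < l" "l < 1" "p \<in> X" "q \<in> X"
    then have "G ((1 - l) *\<^sub>R p + l *\<^sub>R q) \<le> (1 - l) * G p + l * G q"
      by (intro convex_onD[OF convex_G]) auto
    then show "G ((1 - l) *\<^sub>R p + l *\<^sub>R q) + y' \<bullet> (A *v ((1 - l) *\<^sub>R p + l *\<^sub>R q))
        \<le> (1 - l) * (G p + y' \<bullet> (A *v p)) + l * (G q + y' \<bullet> (A *v q))"
      by (simp add: matrix_vector_right_distrib matrix_vector_mult_scaleR inner_simps algebra_simps)
  qed
  have ne: "X \<noteq> {}" "Y \<noteq> {}" using u by auto
  note Y_step = arg_min_on_prox[OF closed_Y ne(2) cY vY c_pos, where a = "snd u", folded y'_def]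
  note X_step = arg_min_on_prox[OF closed_X ne(1) cX vX c_pos, where a = "fst u", folded x'_def]
  show "u' \<in> X \<times> Y" using Y_step(1) X_step(1) u' by simp
  show "gap u' w \<le> c * (norm (w - u))\<^sup>2 - c * (norm (w - u'))\<^sup>2 - c * (norm (u' - u))\<^sup>2
      + (snd w - snd u') \<bullet> (A *v (\<delta>' - \<delta>))" if w: "w \<in> X \<times> Y"
  proof -
    have sq: "(norm (p - q))\<^sup>2 = (norm (fst p - fst q))\<^sup>2 + (norm (snd p - snd q))\<^sup>2"
      for p q :: "(real ^ 'p) \<times> (real ^ 'm)"
      by (simp add: norm_prod_def)
    have "\<delta>' - \<delta> = x' - xh" using \<delta>' u' by (simp add: \<delta>_def xh_def u_def)
    then have "(snd w - snd u') \<bullet> (A *v (\<delta>' - \<delta>))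
      = snd w \<bullet> (A *v x') - snd w \<bullet> (A *v xh) - y' \<bullet> (A *v x') + y' \<bullet> (A *v xh)"
      using u' by (simp add: matrix_vector_mult_diff_distrib inner_simps)
    moreover have "(Fs y' - y' \<bullet> (A *v xh)) + c * (norm (y' - snd u))\<^sup>2 + c * (norm (snd w - y'))\<^sup>2
        \<le> (Fs (snd w) - snd w \<bullet> (A *v xh)) + c * (norm (snd w - snd u))\<^sup>2"
      using w by (intro Y_step(2)) auto
    moreover have "(G x' + y' \<bullet> (A *v x')) + c * (norm (x' - fst u))\<^sup>2 + c * (norm (fst w - x'))\<^sup>2
        \<le> (G (fst w) + y' \<bullet> (A *v fst w)) + c * (norm (fst w - fst u))\<^sup>2"
      using w by (intro X_step(2)) auto
    ultimately show ?thesis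
      unfolding gap_def saddle_fun_def sq u' fst_conv snd_conv distrib_left by linarith
  qed
qed

lemma state_in: "v \<in> X \<times> Y \<Longrightarrow> fst (state v t) \<in> X \<times> Y"
proof (induction t)
  case 0
  then show ?case by simp
next
  case (Suc t)
  show ?case by (rule state_Suc_estimate(1)[OF Suc.IH[OF Suc.prems]])
qed

text \<open>The cross terms telescope up to one product of the current dual displacement with
  \<open>\<delta> t\<close>. Young's inequality pays for it with the dual part of the current step
  and the primal part of the previous one, which is why
  \<open>c * (norm (\<delta> t))\<^sup>2\<close> is carried in the invariant.\<close>

lemma gap_sum_invariant:
  assumes v: "v \<in> X \<times> Y" and w: "w \<in> X \<times> Y"
  defines "u \<equiv> \<lambda>t. fst (state v t)" and "\<delta> \<equiv> \<lambda>t. snd (state v t) - fst (fst (state v t))"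
  shows "(\<Sum>k=1..t. gap (u k) w) \<le> c * (norm (w - v))\<^sup>2 - c * (norm (w - u t))\<^sup>2
    - c * (norm (\<delta> t))\<^sup>2 + (snd w - snd (u t)) \<bullet> (A *v \<delta> t)"
proof (induction t)
  case 0
  show ?case by (simp add: u_def \<delta>_def)
next
  case (Suc t)
  let ?e = "u (Suc t) - u t"
  note step = state_Suc_estimate[OF state_in[OF v, of t]]
  have "(norm ?e)\<^sup>2 = (norm (\<delta> (Suc t)))\<^sup>2 + (norm (snd (u (Suc t)) - snd (u t)))\<^sup>2"
    using step(2) by (simp add: norm_prod_def u_def \<delta>_def)
  then have e: "c * (norm ?e)\<^sup>2
      = c * (norm (\<delta> (Suc t)))\<^sup>2 + c * (norm (snd (u (Suc t)) - snd (u t)))\<^sup>2"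
    by (simp only: distrib_left)
  have "(snd (u (Suc t)) - snd (u t)) \<bullet> (A *v \<delta> t)
      \<le> c * (norm (snd (u (Suc t)) - snd (u t)))\<^sup>2 * (\<gamma> * L)\<^sup>2 + c * (norm (\<delta> t))\<^sup>2"
    by (rule inner_A_le)
  also have "\<dots> \<le> c * (norm (snd (u (Suc t)) - snd (u t)))\<^sup>2 * 1 + c * (norm (\<delta> t))\<^sup>2"
    using c_pos step_pos L_nonneg step_bound
    by (intro add_mono mult_left_mono power_le_one) auto
  finally have cross: "(snd (u (Suc t)) - snd (u t)) \<bullet> (A *v \<delta> t)
      \<le> c * (norm (snd (u (Suc t)) - snd (u t)))\<^sup>2 + c * (norm (\<delta> t))\<^sup>2" by simp
  have "gap (u (Suc t)) w \<le> c * (norm (w - u t))\<^sup>2 - c * (norm (w - u (Suc t)))\<^sup>2 - c * (norm ?e)\<^sup>2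
      + (snd w - snd (u (Suc t))) \<bullet> (A *v (\<delta> (Suc t) - \<delta> t))"
    using step(3)[OF w] by (simp only: u_def \<delta>_def)
  moreover have "(snd w - snd (u (Suc t))) \<bullet> (A *v (\<delta> (Suc t) - \<delta> t))
      = (snd w - snd (u (Suc t))) \<bullet> (A *v \<delta> (Suc t)) - (snd w - snd (u t)) \<bullet> (A *v \<delta> t)
        + (snd (u (Suc t)) - snd (u t)) \<bullet> (A *v \<delta> t)"
    by (simp add: matrix_vector_mult_diff_distrib inner_simps)
  moreover have "(\<Sum>k=1..Suc t. gap (u k) w) = (\<Sum>k=1..t. gap (u k) w) + gap (u (Suc t)) w"
    by simp
  ultimately show ?case using Suc.IH e cross by linarith
qed

text \<open>Young's inequality for the last cross term cancels the \<open>\<delta>\<close> term and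
  costs only the fraction \<open>(\<gamma> * L)\<^sup>2\<close> of the distance term. The surviving
  part is what confines the iterates.\<close>

lemma gap_sum_le:
  assumes v: "v \<in> X \<times> Y" and w: "w \<in> X \<times> Y"
  shows "(\<Sum>k=1..t. gap (fst (state v k)) w)
    \<le> c * (norm (w - v))\<^sup>2 - (1 - (\<gamma> * L)\<^sup>2) * (c * (norm (w - fst (state v t)))\<^sup>2)"
proof -
  let ?u = "fst (state v t)" and ?\<delta> = "snd (state v t) - fst (fst (state v t))"
  have "(snd w - snd ?u) \<bullet> (A *v ?\<delta>)
      \<le> c * (norm (snd w - snd ?u))\<^sup>2 * (\<gamma> * L)\<^sup>2 + c * (norm ?\<delta>)\<^sup>2"
    by (rule inner_A_le)
  also have "(norm (snd w - snd ?u))\<^sup>2 \<le> (norm (w - ?u))\<^sup>2"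
    by (simp add: norm_prod_def)
  then have "c * (norm (snd w - snd ?u))\<^sup>2 * (\<gamma> * L)\<^sup>2 + c * (norm ?\<delta>)\<^sup>2
      \<le> c * (norm (w - ?u))\<^sup>2 * (\<gamma> * L)\<^sup>2 + c * (norm ?\<delta>)\<^sup>2"
    using c_pos by (intro add_mono mult_right_mono mult_left_mono) auto
  finally show ?thesis using gap_sum_invariant[OF v w, of t] by (simp add: algebra_simps)
qed

lemma average_in:
  assumes "v \<in> X \<times> Y" "1 \<le> t"
  shows "pdhg_average X Y A G Fs \<gamma> v t \<in> X \<times> Y"
  unfolding pdhg_average_def scaleR_sum_right
  using assms convex_Times[OF convex_X convex_Y]
  by (intro convex_sum) (auto intro: state_in)

text \<open>Jensen's inequality in the first argument of the gap, after dropping the nonnegative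
  distance term.\<close>

lemma gap_average_le:
  assumes v: "v \<in> X \<times> Y" and w: "w \<in> X \<times> Y" and t: "1 \<le> t"
  shows "gap (pdhg_average X Y A G Fs \<gamma> v t) w \<le> c / t * (norm (w - v))\<^sup>2"
proof -
  have "(\<gamma> * L)\<^sup>2 \<le> 1" using step_pos L_nonneg step_bound by (intro power_le_one) auto
  then have "0 \<le> (1 - (\<gamma> * L)\<^sup>2) * (c * (norm (w - fst (state v t)))\<^sup>2)"
    using c_pos by simp
  then have S: "(\<Sum>k=1..t. gap (fst (state v k)) w) \<le> c * (norm (w - v))\<^sup>2"
    using gap_sum_le[OF v w, of t] by linarith
  have "gap (pdhg_average X Y A G Fs \<gamma> v t) w \<le> (\<Sum>k=1..t. (1 / real t) * gap (fst (state v k)) w)"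
    unfolding pdhg_average_def scaleR_sum_right
    using t by (intro convex_on_sum[OF _ _ convex_on_gap]) (auto intro: state_in[OF v])
  also have "\<dots> = (1 / real t) * (\<Sum>k=1..t. gap (fst (state v k)) w)"
    by (simp only: sum_distrib_left)
  also have "\<dots> \<le> (1 / real t) * (c * (norm (w - v))\<^sup>2)"
    using S by (intro mult_left_mono) auto
  finally show ?thesis by simp
qed

text \<open>The gap of every iterate towards an optimal point is nonnegative, so the distance term
  of \<open>gap_sum_le\<close> is bounded by the initial one. Balls are convex, hence the average
  obeys the same bound.\<close>

lemma dist_average_optimal_le:
  assumes v: "v \<in> X \<times> Y" and w: "w \<in> optimal_set X Y (saddle_fun A G Fs)" and t: "1 \<le> t"
    and q: "0 \<le> q" "1 \<le> q\<^sup>2 * (1 - (\<gamma> * L)\<^sup>2)"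
  shows "dist w (pdhg_average X Y A G Fs \<gamma> v t) \<le> q * dist w v"
proof -
  have wW: "w \<in> X \<times> Y" using w by (simp add: optimal_set_def)
  have "dist w (fst (state v k)) \<le> q * dist w v" for k
  proof -
    have "0 \<le> (\<Sum>j=1..k. gap (fst (state v j)) w)"
      using optimal_gap_nonpos[OF w state_in[OF v]] gap_antisym[of _ w] by (intro sum_nonneg) simp
    then have "c * ((1 - (\<gamma> * L)\<^sup>2) * (norm (w - fst (state v k)))\<^sup>2) \<le> c * (norm (w - v))\<^sup>2"
      using gap_sum_le[OF v wW, of k] by (simp add: algebra_simps)
    then have "(1 - (\<gamma> * L)\<^sup>2) * (norm (w - fst (state v k)))\<^sup>2 \<le> (norm (w - v))\<^sup>2"
      using c_pos mult_le_cancel_left_pos by blast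
    then have "q\<^sup>2 * ((1 - (\<gamma> * L)\<^sup>2) * (norm (w - fst (state v k)))\<^sup>2) \<le> q\<^sup>2 * (norm (w - v))\<^sup>2"
      by (intro mult_left_mono) auto
    moreover have "1 * (norm (w - fst (state v k)))\<^sup>2
        \<le> (q\<^sup>2 * (1 - (\<gamma> * L)\<^sup>2)) * (norm (w - fst (state v k)))\<^sup>2"
      using q by (intro mult_right_mono) auto
    ultimately have "(norm (w - fst (state v k)))\<^sup>2 \<le> (q * norm (w - v))\<^sup>2"
      by (simp add: power_mult_distrib mult.assoc)
    then have "norm (w - fst (state v k)) \<le> q * norm (w - v)"
      by (rule power2_le_imp_le) (use q in simp)
    then show ?thesis by (simp add: dist_norm)
  qed
  then have "fst (state v k) \<in> cball w (q * dist w v)" for k by simp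
  then have "pdhg_average X Y A G Fs \<gamma> v t \<in> cball w (q * dist w v)"
    unfolding pdhg_average_def scaleR_sum_right
    using t by (intro convex_sum) auto
  then show ?thesis by simp
qed

text \<open>
  The gap is concave in its second argument and vanishes on the diagonal, so the growth
  condition at radius \<open>d\<close> transfers to every radius \<open>l * d\<close> with \<open>l \<le> 1\<close>.
\<close>

lemma growth_average_le:
  assumes v: "v \<in> X \<times> Y" and t: "1 \<le> t" and d: "0 \<le> d" and l: "0 \<le> l" "l \<le> 1"
  defines "w \<equiv> pdhg_average X Y A G Fs \<gamma> v t"
  shows "l * local_gap X Y (saddle_fun A G Fs) d w \<le> c / t * (l * d + norm (w - v))\<^sup>2"
proof (cases "l = 0")
  case True
  then show ?thesis using c_pos by simp
next
  case False
  then have l0: "0 < l" using l by simp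
  have w: "w \<in> X \<times> Y" unfolding w_def by (rule average_in[OF v t])
  have "gap w q \<le> c / t * (l * d + norm (w - v))\<^sup>2 / l" if q: "q \<in> cball w d \<inter> X \<times> Y" for q
  proof -
    define p where "p = (1 - l) *\<^sub>R w + l *\<^sub>R q"
    have p: "p \<in> X \<times> Y"
      unfolding p_def using convex_Times[OF convex_X convex_Y] w q l by (intro convexD) auto
    have "gap p w \<le> (1 - l) * gap w w + l * gap q w"
      unfolding p_def using convex_on_gap w q l by (intro convex_onD) auto
    then have "l * gap w q \<le> gap w p"
      using gap_antisym[of p w] gap_antisym[of q w] by (simp add: gap_self)
    also have "\<dots> \<le> c / t * (norm (p - v))\<^sup>2"
      unfolding w_def by (rule gap_average_le[OF v p t])
    also have "\<dots> \<le> c / t * (l * d + norm (w - v))\<^sup>2"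
    proof (intro mult_left_mono power_mono)
      have pv: "p - v = l *\<^sub>R (q - w) + (w - v)" by (simp add: p_def algebra_simps)
      have "norm (p - v) \<le> l * norm (q - w) + norm (w - v)"
        unfolding pv using norm_triangle_ineq[of "l *\<^sub>R (q - w)" "w - v"] l by simp
      also have "l * norm (q - w) \<le> l * d"
        using q l by (intro mult_left_mono) (auto simp: dist_norm norm_minus_commute)
      finally show "norm (p - v) \<le> l * d + norm (w - v)" by simp
    qed (use c_pos in auto)
    finally have "l * gap w q \<le> c / t * (l * d + norm (w - v))\<^sup>2" .
    then show ?thesis using l0 by (subst pos_le_divide_eq) (simp_all add: mult.commute)
  qed
  then have "local_gap X Y (saddle_fun A G Fs) d w \<le> c / t * (l * d + norm (w - v))\<^sup>2 / l"
    unfolding local_gap_eq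
  proof (intro cSUP_least)
    show "cball w d \<inter> X \<times> Y \<noteq> {}" using w d centre_in_cball[of w d] by blast
  qed auto
  then show ?thesis using l0 by (subst (asm) pos_le_divide_eq) (simp_all add: mult.commute)
qed

end

section \<open>Adaptive restarts\<close>

text \<open>
  The choice \<open>l = s / d\<close> handles short epochs and \<open>l = 1\<close> long ones. With \<open>a = sqrt (t / K)\<close>, the
  latter gives \<open>t * d \<le> K * a\<^sup>2 / (a - 1) * s\<close>, and \<open>4 + a\<^sup>2 / 10\<close> lies above \<open>a\<^sup>2 / (a - 1)\<close> on \<open>a \<ge> 2\<close>.
\<close>

lemma growth_imp_linear_bound:
  fixes d s t K :: real
  assumes d: "0 \<le> d" and s: "0 \<le> s" and t: "0 < t" and K: "0 < K"
    and growth: "\<And>l. 0 \<le> l \<Longrightarrow> l \<le> 1 \<Longrightarrow> l * (t * d\<^sup>2) \<le> K * (l * d + s)\<^sup>2"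
  shows "t * d \<le> (4 * K + t / 10) * s"
proof (cases "d = 0")
  case True
  then show ?thesis using s t K by simp
next
  case False
  then have d0: "0 < d" using d by simp
  have s0: "0 < s"
  proof (rule ccontr)
    assume "\<not> 0 < s"
    then have [simp]: "s = 0" using s by simp
    \<comment> \<open>For \<open>s = 0\<close> the growth condition reduces to
      \<open>t \<le> K * l\<close> for positive \<open>l\<close>; this choice makes
      \<open>K * l\<close> at most \<open>t / 2\<close>.\<close>
    define l where "l = min 1 (t / (2 * K))"
    have l: "0 < l" "l \<le> 1" "2 * (K * l) \<le> t" using t K by (auto simp: l_def min_def field_simps)
    have "l * (t * d\<^sup>2) \<le> K * (l * d)\<^sup>2" using growth[of l] l by simp
    then have "l * d\<^sup>2 * t \<le> l * d\<^sup>2 * (K * l)" by (simp add: power2_eq_square algebra_simps)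
    then have "t \<le> K * l" using l d0 by simp
    moreover have "0 < K * l" using K l by simp
    ultimately show False using l(3) by linarith
  qed
  show ?thesis
  proof (cases "s \<le> d")
    case True
    \<comment> \<open>With \<open>l = s / d\<close> the product \<open>l * d\<close> is
      \<open>s\<close>, and the right-hand side becomes \<open>4 * K * s\<^sup>2\<close>.\<close>
    have "s / d * (t * d\<^sup>2) \<le> K * (s / d * d + s)\<^sup>2"
      using True d0 s0 by (intro growth) auto
    then have "s * (t * d) \<le> s * (4 * K * s)" using d0 by (simp add: power2_eq_square algebra_simps)
    then have "t * d \<le> 4 * K * s" using s0 by simp
    moreover have "0 \<le> t / 10 * s" using s0 t by simp
    ultimately show ?thesis unfolding distrib_right by linarith
  next
    case False
    define a where "a = sqrt (t / K)"
    have a: "0 < a" "t = K * a\<^sup>2" using t K by (auto simp: a_def)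
    have "K * (a * d)\<^sup>2 \<le> K * (d + s)\<^sup>2"
      using growth[of 1] a by (simp add: power_mult_distrib algebra_simps)
    then have "(a * d)\<^sup>2 \<le> (d + s)\<^sup>2" using K by simp
    then have ad: "a * d \<le> d + s" by (rule power2_le_imp_le) (use d s in simp)
    have "a\<^sup>2 * d \<le> (4 + a\<^sup>2 / 10) * s"
    proof (cases "a \<le> 2")
      case True
      have "a\<^sup>2 \<le> 2\<^sup>2" using True a by (intro power_mono) auto
      then have "a\<^sup>2 * d \<le> 4 * s" using False d by (intro mult_mono) auto
      moreover have "0 \<le> a\<^sup>2 / 10 * s" using s by simp
      ultimately show ?thesis unfolding distrib_right by linarith
    next
      case a2: False
      have poly: "a\<^sup>2 \<le> (4 + a\<^sup>2 / 10) * (a - 1)"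
      proof -
        \<comment> \<open>The cubic difference is split into a square times \<open>a - 2\<close> and
          a positive remainder, so its sign is evident for \<open>a > 2\<close>.\<close>
        have "0 \<le> ((a - 2) * (a - 9/2)\<^sup>2 + 7/4 * a + 1/2) / 10" using a2 by simp
        also have "\<dots> = (4 + a\<^sup>2 / 10) * (a - 1) - a\<^sup>2"
          by (simp add: power2_eq_square field_simps)
        finally show ?thesis by (simp only: diff_ge_0_iff_ge)
      qed
      have "a\<^sup>2 * d \<le> (4 + a\<^sup>2 / 10) * (a - 1) * d" using poly d by (rule mult_right_mono)
      also have "\<dots> = (4 + a\<^sup>2 / 10) * (a * d - d)" by (simp add: algebra_simps)
      also have "\<dots> \<le> (4 + a\<^sup>2 / 10) * s" using ad by (intro mult_left_mono) auto
      finally show ?thesis .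
    qed
    then have "K * (a\<^sup>2 * d) \<le> K * ((4 + a\<^sup>2 / 10) * s)" using K by simp
    then show ?thesis using a(2) by (simp add: algebra_simps)
  qed
qed

section \<open>Counting epochs and steps\<close>

lemma ex_nat_ivl_ln:
  fixes x :: real
  assumes "1 \<le> x"
  obtains m :: nat where "m * ln 2 \<le> ln x" "x \<le> 2 ^ (m + 1)"
proof
  define m where "m = nat \<lfloor>log 2 x\<rfloor>"
  have "0 \<le> log 2 x" using assms by simp
  then have m: "real m \<le> log 2 x" "log 2 x \<le> real (m + 1)" unfolding m_def by linarith+
  show "m * ln 2 \<le> ln x" using m(1) by (simp add: log_def field_simps)
  have "x \<le> 2 powr real (m + 1)" using m(2) assms by (subst (asm) log_le_iff) auto
  then show "x \<le> 2 ^ (m + 1)" by (subst (asm) powr_realpow) auto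
qed

text \<open>PDHG enters only through \<open>move\<close> and \<open>progress\<close>, with
  \<open>d\<close> in the role of the distance to the optimal set. The passed tests are part of the
  conclusion because a \<open>LEAST\<close> without a witness would make the epoch lengths
  meaningless.\<close>

lemma adaptive_restart_complexity:
  fixes alg :: "'w::real_normed_vector \<Rightarrow> nat \<Rightarrow> 'w" and d :: "'w \<Rightarrow> real" and \<kappa> \<epsilon> :: real
  assumes run: "adaptive_restart alg (1/2) v \<tau>" and v0: "v 0 \<in> W"
    and alg_in: "\<And>w t. w \<in> W \<Longrightarrow> 1 \<le> t \<Longrightarrow> alg w t \<in> W"
    and move: "\<And>w t. w \<in> W \<Longrightarrow> 1 \<le> t \<Longrightarrow> norm (alg w t - w) \<le> 5/2 * d w"
    and progress: "\<And>w t. w \<in> W \<Longrightarrow> 1 \<le> t \<Longrightarrow>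
      real t * d (alg w t) \<le> (20/7 * \<kappa> + real t / 10) * norm (alg w t - w)"
    and d: "\<And>w. 0 \<le> d w" and \<kappa>: "1 \<le> \<kappa>" and \<epsilon>: "0 < \<epsilon>" "\<epsilon> < 1"
  shows "\<exists>n\<ge>1. (\<forall>i\<in>{2..n}. \<exists>t\<ge>1. restart_test alg (1/2) v \<tau> i t) \<and>
    d (v n) \<le> \<epsilon> * d (v 0) \<and>
    real (\<Sum>i=1..n. \<tau> i) \<le> 57 * \<kappa> * ln (4 / \<epsilon>)
      + max (57 * \<kappa> * ln (max 1 (77 * \<kappa> / real (\<tau> 1)))) (2 * real (\<tau> 1))"
proof -
  define z where "z i = norm (v i - v (i - 1)) / real (\<tau> i)" for i
  have z_nonneg: "0 \<le> z i" for i by (simp add: z_def)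
  have \<tau>1: "1 \<le> \<tau> 1"
    and \<tau>_eq: "\<And>i. 2 \<le> i \<Longrightarrow> \<tau> i = (LEAST t. 1 \<le> t \<and> restart_test alg (1/2) v \<tau> i t)"
    and v_eq: "\<And>i. 1 \<le> i \<Longrightarrow> v i = alg (v (i - 1)) (\<tau> i)"
    using run by (auto simp: adaptive_restart_def)
  \<comment> \<open>The invariant holds what the next epoch needs: progress expressed by the
    normalized movement \<open>z i\<close>, and positivity of the length dividing it.\<close>
  define good where "good i \<longleftrightarrow> v i \<in> W \<and> 1 \<le> \<tau> i \<and> d (v i) \<le> (20/7 * \<kappa> + real (\<tau> i) / 10) * z i" for i
  have goodI: "good i" if "1 \<le> i" "v (i - 1) \<in> W" "1 \<le> \<tau> i" for i
    using alg_in[OF that(2,3)] progress[OF that(2,3)] that v_eq[OF that(1)]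
    by (simp add: good_def z_def field_simps)
  have epoch: "(\<exists>t\<ge>1. restart_test alg (1/2) v \<tau> (Suc i) t) \<and> good (Suc i)
      \<and> real (\<tau> (Suc i)) \<le> 16 * \<kappa> + real (\<tau> i) / 2 \<and> z (Suc i) \<le> z i / 2"
    if i: "1 \<le> i" and g: "good i" for i
  proof -
    have v: "v i \<in> W" "1 \<le> \<tau> i" "d (v i) \<le> (20/7 * \<kappa> + real (\<tau> i) / 10) * z i"
      using g by (auto simp: good_def)
    \<comment> \<open>By \<open>move\<close>, step \<open>t\<close> passes once
      \<open>5/2 * d (v i) \<le> t * (z i / 2)\<close>; the bound on \<open>d (v i)\<close> makes
      \<open>t \<ge> b\<close> sufficient.\<close>
    define b where "b = 5 * (20/7 * \<kappa> + real (\<tau> i) / 10)"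
    have b: "0 < b" using \<kappa> by (simp add: b_def)
    have test_iff: "restart_test alg (1/2) v \<tau> (Suc i) t
        \<longleftrightarrow> norm (alg (v i) t - v i) / real t \<le> z i / 2" for t
      using i by (simp add: restart_test_def z_def numeral_2_eq_2 mult.commute)
    define t where "t = nat \<lceil>b\<rceil>"
    have t: "1 \<le> t" "b \<le> real t" "real t \<le> b + 1" using b unfolding t_def by linarith+
    have "norm (alg (v i) t - v i) \<le> 5/2 * d (v i)" by (rule move[OF v(1) t(1)])
    also have "\<dots> \<le> b * (z i / 2)" using v(3) by (simp add: b_def algebra_simps)
    also have "\<dots> \<le> real t * (z i / 2)" using t z_nonneg by (intro mult_right_mono) auto
    finally have test: "restart_test alg (1/2) v \<tau> (Suc i) t"
      using t by (simp add: test_iff field_simps)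
    have \<tau>S: "\<tau> (Suc i) = (LEAST t. 1 \<le> t \<and> restart_test alg (1/2) v \<tau> (Suc i) t)"
      using i by (intro \<tau>_eq) simp
    have test_t: "1 \<le> t \<and> restart_test alg (1/2) v \<tau> (Suc i) t" using test t(1) by simp
    have least: "1 \<le> \<tau> (Suc i) \<and> restart_test alg (1/2) v \<tau> (Suc i) (\<tau> (Suc i))"
      using LeastI[of "\<lambda>t. 1 \<le> t \<and> restart_test alg (1/2) v \<tau> (Suc i) t", OF test_t]
      by (simp only: \<tau>S[symmetric])
    have "\<tau> (Suc i) \<le> t"
      using Least_le[of "\<lambda>t. 1 \<le> t \<and> restart_test alg (1/2) v \<tau> (Suc i) t", OF test_t]
      by (simp only: \<tau>S[symmetric])
    then have "real (\<tau> (Suc i)) \<le> b + 1" using t by linarith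
    \<comment> \<open>Here \<open>b + 1 = 100/7 * \<kappa> + \<tau> i / 2 + 1\<close>, and
      \<open>\<kappa> \<ge> 1\<close> absorbs the 1 lost in rounding up.\<close>
    then have "real (\<tau> (Suc i)) \<le> 16 * \<kappa> + real (\<tau> i) / 2" using \<kappa> by (simp add: b_def)
    moreover have "z (Suc i) \<le> z i / 2"
      using least v_eq[of "Suc i"] by (simp add: test_iff z_def[of "Suc i"])
    moreover have "good (Suc i)" using least v(1) by (intro goodI) auto
    ultimately show ?thesis using test t(1) by blast
  qed
  have good: "good (Suc m)" for m
  proof (induction m)
    case 0
    show ?case using goodI[of 1] v0 \<tau>1 by simp
  next
    case (Suc m)
    then show ?case using epoch[of "Suc m"] by simp
  qed
  have tests: "\<forall>i\<in>{2..n}. \<exists>t\<ge>1. restart_test alg (1/2) v \<tau> i t" for n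
  proof
    fix i assume "i \<in> {2..n}"
    then obtain m where "i = Suc (Suc m)" using that[of "i - 2"] by force
    then show "\<exists>t\<ge>1. restart_test alg (1/2) v \<tau> i t" using epoch[of "Suc m"] good[of m] by simp
  qed
  \<comment> \<open>\<open>T\<close> is the fixed point of the map taking \<open>x\<close> to
    \<open>16 * \<kappa> + x / 2\<close>. The deviation \<open>E\<close> from it may be negative;
    its contribution to the bound halves in each epoch.\<close>
  define T where "T = 32 * \<kappa>"
  define E where "E = real (\<tau> 1) - T"
  have \<tau>_le: "real (\<tau> (Suc m)) \<le> T + E / 2 ^ m" for m
  proof (induction m)
    case 0
    show ?case by (simp add: E_def)
  next
    case (Suc m)
    have "real (\<tau> (Suc (Suc m))) \<le> T / 2 + real (\<tau> (Suc m)) / 2"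
      using epoch[of "Suc m"] good[of m] by (simp add: T_def)
    also have "\<dots> \<le> T / 2 + (T + E / 2 ^ m) / 2" using Suc.IH by simp
    also have "\<dots> = T + E / 2 ^ Suc m" by (simp add: field_simps)
    finally show ?case .
  qed
  have z_le: "z (Suc m) \<le> z 1 / 2 ^ m" for m
  proof (induction m)
    case 0
    show ?case by simp
  next
    case (Suc m)
    have "z (Suc (Suc m)) \<le> z (Suc m) / 2" using epoch[of "Suc m"] good[of m] by simp
    also have "\<dots> \<le> (z 1 / 2 ^ m) / 2" using Suc.IH by simp
    finally show ?case by (simp add: mult.commute)
  qed
  \<comment> \<open>The factor \<open>2 - 1 / 2 ^ m\<close> is the geometric sum of the halved
    deviations.\<close>
  have sum_le: "real (\<Sum>i=1..Suc m. \<tau> i) \<le> real (m + 1) * T + E * (2 - 1 / 2 ^ m)" for m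
  proof (induction m)
    case 0
    show ?case by (simp add: E_def)
  next
    case (Suc m)
    have "real (\<Sum>i=1..Suc (Suc m). \<tau> i) = real (\<Sum>i=1..Suc m. \<tau> i) + real (\<tau> (Suc (Suc m)))"
      by simp
    also have "\<dots> \<le> (real (m + 1) * T + E * (2 - 1 / 2 ^ m)) + (T + E / 2 ^ Suc m)"
      by (intro add_mono Suc.IH \<tau>_le)
    also have "\<dots> = real (Suc m + 1) * T + E * (2 - 1 / 2 ^ Suc m)"
      by (simp add: field_simps)
    finally show ?case .
  qed
  have "norm (v 1 - v 0) \<le> 5/2 * d (v 0)" using move[OF v0 \<tau>1] v_eq[of 1] by simp
  then have z1: "z 1 \<le> 5/2 * d (v 0) / real (\<tau> 1)"
    unfolding z_def diff_self_eq_0 by (rule divide_right_mono) simp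
  \<comment> \<open>\<open>C\<close> combines the factor \<open>5/2\<close> of \<open>move\<close>
    in the first epoch with the ratio of lengths to \<open>\<tau> 1\<close>; short and long first
    epochs call for different values.\<close>
  have d_le: "d (v (Suc m)) \<le> C / 2 ^ m * d (v 0)"
    if C: "(20/7 * \<kappa> + real (\<tau> (Suc m)) / 10) * (5/2) \<le> C * real (\<tau> 1)" for m C
  proof -
    have "d (v (Suc m)) \<le> (20/7 * \<kappa> + real (\<tau> (Suc m)) / 10) * z (Suc m)"
      using good by (simp add: good_def)
    also have "\<dots> \<le> (20/7 * \<kappa> + real (\<tau> (Suc m)) / 10) * (5/2 * d (v 0) / real (\<tau> 1) / 2 ^ m)"
      using \<kappa> z1 by (intro mult_left_mono order_trans[OF z_le] divide_right_mono) auto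
    also have "\<dots> = ((20/7 * \<kappa> + real (\<tau> (Suc m)) / 10) * (5/2)) * (d (v 0) / real (\<tau> 1) / 2 ^ m)"
      by (simp only: times_divide_eq_right mult.assoc)
    also have "\<dots> \<le> (C * real (\<tau> 1)) * (d (v 0) / real (\<tau> 1) / 2 ^ m)"
      using C d by (intro mult_right_mono) auto
    also have "\<dots> = C / 2 ^ m * d (v 0)" using \<tau>1 by simp
    finally show ?thesis .
  qed
  show ?thesis
  proof (cases "real (\<tau> 1) \<le> T")
    case True
    \<comment> \<open>Short first epoch: lengths stay below \<open>T\<close> and
      \<open>5/2 * (20/7 + 32/10) \<le> 16\<close>, so the accuracy is reached once
      \<open>16 * M \<le> 2 ^ m\<close>, that is \<open>32 * M \<le> 2 ^ (m + 1)\<close>.\<close>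
    define M where "M = \<kappa> / (real (\<tau> 1) * \<epsilon>)"
    have "real (\<tau> 1) * \<epsilon> \<le> real (\<tau> 1) * 1" using \<epsilon> by (intro mult_left_mono) auto
    then have "real (\<tau> 1) * \<epsilon> \<le> 32 * \<kappa>" using True unfolding T_def by linarith
    then have M: "1 \<le> 32 * M" using \<tau>1 \<epsilon> by (simp add: M_def)
    then obtain m where m: "m * ln 2 \<le> ln (32 * M)" "32 * M \<le> 2 ^ (m + 1)" by (rule ex_nat_ivl_ln)
    have E: "E \<le> 0" using True by (simp add: E_def)
    then have "E / 2 ^ m \<le> 0" by (simp add: divide_nonpos_pos)
    then have "real (\<tau> (Suc m)) \<le> T" using \<tau>_le[of m] by linarith
    then have "d (v (Suc m)) \<le> (16 * \<kappa> / real (\<tau> 1)) / 2 ^ m * d (v 0)"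
      using \<tau>1 \<kappa> by (intro d_le) (simp add: T_def)
    also have "(16 * \<kappa> / real (\<tau> 1)) / 2 ^ m \<le> \<epsilon>"
      using m(2) \<tau>1 \<epsilon> by (simp add: M_def field_simps)
    then have "(16 * \<kappa> / real (\<tau> 1)) / 2 ^ m * d (v 0) \<le> \<epsilon> * d (v 0)"
      using d by (rule mult_right_mono)
    finally have dist: "d (v (Suc m)) \<le> \<epsilon> * d (v 0)" .
    have "ln (64 * M) = ln 2 + ln (32 * M)" using M ln_mult[of 2 "32 * M"] by simp
    then have "real (m + 1) * ln 2 \<le> ln (64 * M)" using m(1) by (simp add: algebra_simps)
    moreover have "real (m + 1) * (2/3) \<le> real (m + 1) * ln 2"
      using ln2_ge_two_thirds by (intro mult_left_mono) auto
    \<comment> \<open>Since \<open>308 = 4 * 77\<close>, the enlarged argument splits into the two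
      logarithms of the claim.\<close>
    moreover have "ln (64 * M) \<le> ln (308 * M)" using M by simp
    ultimately have m1: "real (m + 1) \<le> 3/2 * ln (308 * M)" by simp
    have "1 / 2 ^ m \<le> (1::real)" by simp
    then have "(0::real) \<le> 2 - 1 / 2 ^ m" by linarith
    with E have "E * (2 - 1 / 2 ^ m) \<le> 0" by (rule mult_nonpos_nonneg)
    then have "real (\<Sum>i=1..Suc m. \<tau> i) \<le> real (m + 1) * T" using sum_le[of m] by linarith
    \<comment> \<open>The factor \<open>3/2\<close> comes from \<open>ln 2 \<ge> 2/3\<close>, and
      \<open>3/2 * 32 = 48\<close> is below 57.\<close>
    also have "\<dots> \<le> 3/2 * ln (308 * M) * T" using m1 \<kappa> by (intro mult_right_mono) (auto simp: T_def)
    also have "\<dots> = 48 * \<kappa> * ln (308 * M)" by (simp add: T_def)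
    also have "\<dots> \<le> 57 * \<kappa> * ln (308 * M)" using M \<kappa> by (intro mult_right_mono) auto
    also have "ln (308 * M) = ln (4 / \<epsilon>) + ln (77 * \<kappa> / real (\<tau> 1))"
    proof -
      have pos: "0 < 4 / \<epsilon>" "0 < 77 * \<kappa> / real (\<tau> 1)" using \<epsilon> \<kappa> \<tau>1 by auto
      have "308 * M = (4 / \<epsilon>) * (77 * \<kappa> / real (\<tau> 1))" by (simp add: M_def mult.commute)
      then show ?thesis using ln_mult_pos[OF pos] by (simp only:)
    qed
    also have "57 * \<kappa> * \<dots> \<le> 57 * \<kappa> * (ln (4 / \<epsilon>) + ln (max 1 (77 * \<kappa> / real (\<tau> 1))))"
      using \<kappa> \<tau>1 by (intro mult_left_mono add_left_mono ln_mono) auto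
    also have "\<dots> \<le> 57 * \<kappa> * ln (4 / \<epsilon>)
      + max (57 * \<kappa> * ln (max 1 (77 * \<kappa> / real (\<tau> 1)))) (2 * real (\<tau> 1))"
      by (simp add: distrib_left)
    finally show ?thesis using dist tests[of "Suc m"] by (intro exI[of _ "Suc m"]) auto
  next
    case False
    \<comment> \<open>Long first epoch: lengths never exceed \<open>\<tau> 1\<close>, and
      \<open>\<kappa> < \<tau> 1 / 32\<close> gives
      \<open>5/2 * (20/7 / 32 + 1/10) \<le> 1/2\<close>. So \<open>C = 1/2\<close>, and the number
      of epochs depends on \<open>\<epsilon>\<close> only.\<close>
    have "1 \<le> 1 / \<epsilon>" using \<epsilon> by simp
    then obtain m where m: "m * ln 2 \<le> ln (1 / \<epsilon>)" "1 / \<epsilon> \<le> 2 ^ (m + 1)" by (rule ex_nat_ivl_ln)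
    have E: "0 \<le> E" using False by (simp add: E_def)
    have "E / 2 ^ m \<le> E / 1" using E by (intro divide_left_mono) auto
    then have "real (\<tau> (Suc m)) \<le> real (\<tau> 1)" using \<tau>_le[of m] by (simp add: E_def)
    then have "d (v (Suc m)) \<le> (1/2) / 2 ^ m * d (v 0)"
      using False by (intro d_le) (simp add: T_def)
    also have "(1/2) / 2 ^ m \<le> \<epsilon>" using m(2) \<epsilon> by (simp add: field_simps)
    then have "(1/2) / 2 ^ m * d (v 0) \<le> \<epsilon> * d (v 0)" using d by (rule mult_right_mono)
    finally have dist: "d (v (Suc m)) \<le> \<epsilon> * d (v 0)" .
    have "real m * (2/3) \<le> real m * ln 2"
      using ln2_ge_two_thirds by (intro mult_left_mono) auto
    moreover have "ln (1 / \<epsilon>) \<le> ln (4 / \<epsilon>)" using \<epsilon> by (simp add: field_simps)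
    ultimately have m1: "real m \<le> 3/2 * ln (4 / \<epsilon>)" using m(1) by simp
    \<comment> \<open>The total \<open>(m + 1) * T + 2 * (\<tau> 1 - T)\<close> is at most
      \<open>m * T + 2 * \<tau> 1\<close>, which produces the second branch of the maximum.\<close>
    have "E * (2 - 1 / 2 ^ m) \<le> E * 2" using E by (intro mult_left_mono) auto
    then have "real (\<Sum>i=1..Suc m. \<tau> i) \<le> real m * T + 2 * real (\<tau> 1)"
      using sum_le[of m] \<kappa> by (simp add: E_def T_def algebra_simps)
    also have "real m * T \<le> 3/2 * ln (4 / \<epsilon>) * T"
      using m1 \<kappa> by (intro mult_right_mono) (auto simp: T_def)
    also have "\<dots> = 48 * \<kappa> * ln (4 / \<epsilon>)" by (simp add: T_def)
    also have "\<dots> \<le> 57 * \<kappa> * ln (4 / \<epsilon>)" using \<epsilon> \<kappa> by (intro mult_right_mono) auto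
    finally have "real (\<Sum>i=1..Suc m. \<tau> i) \<le> 57 * \<kappa> * ln (4 / \<epsilon>)
      + max (57 * \<kappa> * ln (max 1 (77 * \<kappa> / real (\<tau> 1)))) (2 * real (\<tau> 1))" by simp
    then show ?thesis using dist tests[of "Suc m"] by (intro exI[of _ "Suc m"]) auto
  qed
qed

section \<open>PDHG with step size \<open>0.7 / L\<close>\<close>

theorem corollary1:
  fixes X :: "(real ^ 'p) set" and Y :: "(real ^ 'm) set"
    and A :: "real ^ 'p ^ 'm"
    and G :: "real ^ 'p \<Rightarrow> real" and Fs :: "real ^ 'm \<Rightarrow> real"
    and Z :: "(real ^ 'm) set" and F :: "real ^ 'm \<Rightarrow> real"
    and L \<theta> \<gamma> \<beta> \<epsilon> :: real
    and f :: "real ^ 'p \<Rightarrow> real ^ 'm \<Rightarrow> real"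
    and Wopt :: "((real ^ 'p) \<times> (real ^ 'm)) set"
    and v :: "nat \<Rightarrow> (real ^ 'p) \<times> (real ^ 'm)" and \<tau> :: "nat \<Rightarrow> nat"
  assumes "closed X" "convex X" "closed Y" "convex Y"
    and "continuous_on X G" "convex_on X G"
    and "continuous_on Y Fs" "convex_on Y Fs"
    and "continuous_on Z F" "convex_on Z F"
    and "\<And>y. y \<in> Y \<Longrightarrow> ereal (Fs y) = convex_conjugate Z F y"
    and "f = saddle_fun A G Fs"
    and "L = onorm ((*v) A)" "0 < \<theta>" "\<theta> \<le> L"
    and "\<gamma> = 0.7 / L" "\<beta> = 0.5"
    and "0 < \<epsilon>" "\<epsilon> < 1"
    and "Wopt = optimal_set X Y f" "Wopt \<noteq> {}"
    and "\<And>w. w \<in> X \<times> Y \<Longrightarrow> \<theta> * (infdist w Wopt)\<^sup>2 \<le> local_gap X Y f (infdist w Wopt) w"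
    and "v 0 \<in> X \<times> Y"
    and "adaptive_restart (pdhg_average X Y A G Fs \<gamma>) \<beta> v \<tau>"
  shows "\<exists>n\<ge>1.
    (\<forall>i\<in>{2..n}. \<exists>t\<ge>1. restart_test (pdhg_average X Y A G Fs \<gamma>) \<beta> v \<tau> i t) \<and>
    infdist (v n) Wopt \<le> \<epsilon> * infdist (v 0) Wopt \<and>
    real (\<Sum>i=1..n. \<tau> i)
      \<le> 57 * (L / \<theta>) * ln (4 / \<epsilon>)
        + max (57 * (L / \<theta>) * ln (max 1 (77 * L / (\<theta> * real (\<tau> 1))))) (2 * real (\<tau> 1))"
proof -
  have L: "0 < L" using assms by simp
  interpret pdhg X Y A G Fs \<gamma> L
  proof
    show "norm (A *v x) \<le> L * norm x" for x
      using onorm[OF matrix_vector_mul_bounded_linear] assms(13) by simp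
  qed (use assms L in auto)
  let ?alg = "pdhg_average X Y A G Fs \<gamma>"
  have f: "f = saddle_fun A G Fs" by (rule assms(12))
  have c: "c = L / 1.4" and \<gamma>L: "\<gamma> * L = 0.7"
    unfolding c_def using assms(16) L by simp_all
  have move: "norm (?alg w t - w) \<le> 5/2 * infdist w Wopt" if w: "w \<in> X \<times> Y" and t: "1 \<le> t" for w t
  proof -
    \<comment> \<open>The triangle inequality through \<open>p\<close> gives
      \<open>5/2 = 3/2 + 1\<close>; with the constant on the left, the infimum over \<open>p\<close>
      can be taken directly.\<close>
    have "norm (?alg w t - w) / (5/2) \<le> dist w p" if p: "p \<in> Wopt" for p
    proof -
      \<comment> \<open>The factor \<open>3/2\<close> is admissible because
        \<open>9/4 * (1 - 0.49) \<ge> 1\<close>.\<close>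
      have "dist p (?alg w t) \<le> 3/2 * dist p w"
        using p assms(20) f
        by (intro dist_average_optimal_le[OF w _ t]) (auto simp only: \<gamma>L, auto simp: power2_eq_square)
      then show ?thesis
        using dist_triangle[of "?alg w t" w p] by (simp add: dist_norm norm_minus_commute)
    qed
    then have "norm (?alg w t - w) / (5/2) \<le> infdist w Wopt"
      unfolding infdist_notempty[OF assms(21)] using assms(21) by (intro cINF_greatest)
    then show ?thesis by simp
  qed
  have progress: "real t * infdist (?alg w t) Wopt \<le> (20/7 * (L/\<theta>) + real t / 10) * norm (?alg w t - w)"
    if w: "w \<in> X \<times> Y" and t: "1 \<le> t" for w t
  proof -
    define d where "d = infdist (?alg w t) Wopt"
    define s where "s = norm (?alg w t - w)"
    have d: "0 \<le> d" by (simp add: d_def infdist_nonneg)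
    \<comment> \<open>Scaling by \<open>t / \<theta>\<close> gives the form with
      \<open>K = c / \<theta> = L / (1.4 * \<theta>)\<close>; then \<open>4 * K\<close> is the
      \<open>20/7 * (L / \<theta>)\<close> required by \<open>progress\<close>.\<close>
    have growth: "l * (real t * d\<^sup>2) \<le> c / \<theta> * (l * d + s)\<^sup>2" if l: "0 \<le> l" "l \<le> 1" for l
    proof -
      have "\<theta> * d\<^sup>2 \<le> local_gap X Y f d (?alg w t)"
        unfolding d_def by (rule assms(22)[OF average_in[OF w t]])
      then have "l * (\<theta> * d\<^sup>2) \<le> l * local_gap X Y f d (?alg w t)" using l by (intro mult_left_mono)
      also have "\<dots> \<le> c / t * (l * d + s)\<^sup>2"
        unfolding f s_def by (rule growth_average_le[OF w t d l])
      finally have "(t / \<theta>) * (l * (\<theta> * d\<^sup>2)) \<le> (t / \<theta>) * (c / t * (l * d + s)\<^sup>2)"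
        using assms(14) by (intro mult_left_mono) auto
      then show ?thesis using assms(14) t by (simp add: mult_ac)
    qed
    have "real t * d \<le> (4 * (c / \<theta>) + real t / 10) * s"
      using d t assms(14) c_pos by (intro growth_imp_linear_bound growth) (auto simp: s_def)
    also have "4 * (c / \<theta>) = 20/7 * (L / \<theta>)" unfolding c by simp
    finally show ?thesis by (simp add: d_def s_def)
  qed
  have \<beta>: "\<beta> = 1/2" using assms(17) by simp
  have \<kappa>: "1 \<le> L / \<theta>" using assms(14,15) by simp
  have "77 * (L / \<theta>) / real (\<tau> 1) = 77 * L / (\<theta> * real (\<tau> 1))" by simp
  with adaptive_restart_complexity[OF assms(24)[unfolded \<beta>] assms(23) average_in move progress
      infdist_nonneg \<kappa> assms(18,19)]
  show ?thesis unfolding \<beta> by (simp only:)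
qed

end
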